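(* Let $x_0$ be the unique number in the interval $[0,\pi/2]$ such that $2\cos x_0 = e^{x_0}$. Let $a>1$ and $b\in(-x_0,x_0)\setminus\{0\}$ be fixed real numbers (where $(-x_0,x_0)\setminus\{0\}\supseteq(-1/3,1/3)\setminus\{0\}$). Define $p(\theta)=p(\theta,a,b)$ by $$2\pi\, p(\theta,a,b) = -1 + 2(a-1)\int_0^1 e^{-bu\cos\theta}\cos(bu\sin\theta)(1-u)^{a-2}\,du,\qquad \theta\in[0,2\pi].$$ Then $p(\theta,a,b)$ is a positive continuous function of $\theta\in[0,2\pi]$, and the generalized Bessel polynomials $y_n(x,a,b)$ satisfy the orthogonality relations $$\int_0^{2\pi} y_n(e^{i\theta},a,b)\,y_m(e^{i\theta},a,b)\,p(\theta,a,b)\,d\theta = -\frac{c_n}{b}\,\delta_{n,m},\qquad n,m\in\mathbb{Z}_+,$$ where $$c_0=-b,\qquad c_k=\frac{(-1)^{k+1}\,b\,k!}{(2k+a-1)\,[k+a-2]_{k-1}},\quad k\in\mathbb{N}.$$ Moreover, the weight $p(\theta,a,b)$ is related to the complex-valued weight $\rho(z,a,b)$ by $$2\pi\, p(\theta,a,b) = -1+\frac{2(a-1)}{b}\cos\theta-\frac{2\pi i}{b}\left(e^{i\theta}\rho(e^{i\theta},a,b)+e^{-i\theta}\rho(e^{-i\theta},a,b)\right),\qquad \theta\in[0,2\pi].$$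
   Context: $\mathbb{N}$ denotes the positive integers, $\mathbb{Z}_+$ the non-negative integers, and $\delta_{n,m}$ the Kronecker delta. For $u\in\mathbb{C}$: $(u)_0:=1$, $(u)_k:=u(u+1)\cdots(u+k-1)$, and $[u]_0:=1$, $[u]_k:=u(u-1)\cdots(u-k+1)$ for $k\in\mathbb{N}$. The generalized Bessel polynomials are $$y_n(x,a,b):={}_2F_0\left(-n,n+a-1;-;-\frac{x}{b}\right)=\sum_{j=0}^n\frac{(-n)_j(n+a-1)_j}{j!}\left(-\frac{x}{b}\right)^j,\qquad n\in\mathbb{Z}_+.$$ The complex-valued weight $\rho$ is $$\rho(z,a,b):=\frac{1}{2\pi i}\sum_{j=0}^\infty\frac{\Gamma(a)}{\Gamma(a+j-1)}\left(-\frac{b}{z}\right)^j,\qquad z\in\mathbb{C}\setminus\{0\}.$$ Note that the orthogonality relation involves the product $y_n y_m$ without complex conjugation. *)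

theory Defs
  imports "HOL-Analysis.Analysis"
begin

definition falling_fact :: "'a::comm_ring_1 \<Rightarrow> nat \<Rightarrow> 'a" where
  "falling_fact u k = (\<Prod>i<k. u - of_nat i)"

definition bessel_poly :: "nat \<Rightarrow> complex \<Rightarrow> complex \<Rightarrow> complex \<Rightarrow> complex" where
  "bessel_poly n x a b =
     (\<Sum>j\<le>n. pochhammer (- of_nat n) j * pochhammer (of_nat n + a - 1) j / fact j * (- (x / b)) ^ j)"

(* If a + j - 1 is a pole of Gamma, its Gamma value is 0 and the quotient below is therefore 0,
   in agreement with the convention 1 / Gamma = 0 there. *)
definition bessel_rho :: "complex \<Rightarrow> complex \<Rightarrow> complex \<Rightarrow> complex" where
  "bessel_rho z a b =
     1 / (2 * of_real pi * \<i>) *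
     (\<Sum>j. Gamma a / Gamma (a + of_nat j - 1) * (- (b / z)) ^ j)"

definition bessel_p :: "real \<Rightarrow> real \<Rightarrow> real \<Rightarrow> real" where
  "bessel_p \<theta> a b =
     (- 1 + 2 * (a - 1) *
        integral {0..1} (\<lambda>u. exp (- b * u * cos \<theta>) * cos (b * u * sin \<theta>) * (1 - u) powr (a - 2)))
     / (2 * pi)"

definition bessel_c :: "nat \<Rightarrow> real \<Rightarrow> real \<Rightarrow> real" where
  "bessel_c k a b =
     (if k = 0 then - b
      else (- 1) ^ (k + 1) * b * fact k
           / ((2 * real k + a - 1) * falling_fact (real k + a - 2) (k - 1)))"

definition bessel_x0 :: real where
  "bessel_x0 = (THE x. x \<in> {0..pi / 2} \<and> 2 * cos x = exp x)"

end

theory Submission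
  imports Defs
begin

text \<open>
  Let \<open>F(z)\<close> be the entire function with Taylor coefficients \<open>\<mu>\<^sub>k = (-b)^k / (a)\<^sub>k\<close>
  (\<open>bessel_gen\<close> and \<open>bessel_moment\<close> below). Expanding the exponential and evaluating Beta integrals,
  \<open>F(z)\<close> is \<open>a - 1\<close> times the integral of \<open>e^(-buz) (1-u)^(a-2)\<close> over the unit interval, so that on the unit
  circle \<open>2 \<pi> p = -1 + F(z) + F(1/z)\<close>. Hence the \<open>\<mu>\<^sub>k\<close> are the moments of \<open>p\<close>, and the Chu-Vandermonde
  identity shows that \<open>y\<^sub>n\<close> is orthogonal to all lower powers. The formula for \<open>\<rho>\<close> follows from
  \<open>2 \<pi> i z \<rho>(z) = (a - 1) z - b F(1/z)\<close>. Positivity holds because the kernel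
  \<open>e^(-bu cos \<theta>) cos (bu sin \<theta>)\<close> is at least \<open>e^(-|b|) cos |b|\<close>, which exceeds \<open>1/2\<close> exactly
  when \<open>e^|b| < 2 cos |b|\<close>.
\<close>

section \<open>The generating function of the moments and its integral representation\<close>

definition bessel_moment :: "real \<Rightarrow> real \<Rightarrow> nat \<Rightarrow> real" where
  "bessel_moment a b k = (- b) ^ k / pochhammer a k"

definition bessel_gen :: "real \<Rightarrow> real \<Rightarrow> complex \<Rightarrow> complex" where
  "bessel_gen a b z = (\<Sum>k. of_real (bessel_moment a b k) * z ^ k)"

lemma bessel_moment_0 [simp]: "bessel_moment a b 0 = 1"
  by (simp add: bessel_moment_def)

text \<open>Euler's Beta integral B(k + 1, a - 1), with
  \<open>Gamma a = (a - 1) * Gamma (a - 1)\<close> used to bring in the Pochhammer symbol. The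
  factor a - 1 in the denominator later cancels against the prefactor in
  \<open>bessel_p\<close>.\<close>

lemma has_integral_power_mult_powr:
  fixes a :: real
  assumes "a > 1"
  shows "((\<lambda>u. u ^ k * (1 - u) powr (a - 2)) has_integral fact k / (pochhammer a k * (a - 1))) {0..1}"
proof -
  have "((\<lambda>u. u powr (real (Suc k) - 1) * (1 - u) powr ((a - 1) - 1))
          has_integral Beta (real (Suc k)) (a - 1)) {0..1}"
    by (rule has_integral_Beta_real) (use assms in auto)
  moreover have "Beta (real (Suc k)) (a - 1) = fact k / (pochhammer a k * (a - 1))"
  proof -
    have "Gamma a = (a - 1) * Gamma (a - 1)"
      using Gamma_plus1[of "a - 1"] assms nonpos_Ints_nonpos[of "a - 1"] by force
    moreover have "pochhammer a k = Gamma (a + real k) / Gamma a"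
      by (rule pochhammer_Gamma) (use assms in \<open>auto elim!: nonpos_Ints_cases\<close>)
    ultimately have "pochhammer a k * (a - 1) = Gamma (a + real k) / Gamma (a - 1)"
      using assms by simp
    moreover have "real (Suc k) + (a - 1) = a + real k" by simp
    ultimately show ?thesis
      using Gamma_fact[of k, where 'a = real] by (simp add: Beta_def add.commute)
  qed
  ultimately have "((\<lambda>u. u powr real k * (1 - u) powr (a - 2))
          has_integral fact k / (pochhammer a k * (a - 1))) {0..1}"
    by simp
  \<comment> \<open>For k = 0 the integrands differ at u = 0, where \<open>u powr 0\<close> is 0 but
    \<open>u ^ 0\<close> is 1; a single point is negligible.\<close>
  then show ?thesis
    by (rule has_integral_spike[of "{0}", rotated 2]) (auto simp: powr_realpow)
qed

lemma fact_le_pochhammer: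
  fixes a :: real
  assumes "a \<ge> 1"
  shows "fact k \<le> pochhammer a k"
  unfolding pochhammer_fact pochhammer_prod by (rule prod_mono) (use assms in auto)

text \<open>Comparing \<open>pochhammer a k\<close> with \<open>fact k\<close> factor by factor
  bounds the moments by the Taylor coefficients of exp at |b|. All later convergence arguments rest
  on this majorant.\<close>

lemma abs_bessel_moment_le:
  assumes "a > 1"
  shows "\<bar>bessel_moment a b k\<bar> \<le> \<bar>b\<bar> ^ k / fact k"
proof -
  have "pochhammer a k > 0" using assms by (intro pochhammer_pos) auto
  then show ?thesis
    using fact_le_pochhammer[of a k] assms
    by (auto simp: bessel_moment_def abs_mult power_abs intro!: divide_left_mono)
qed

lemma norm_bessel_term_le:
  assumes "a > 1"
  shows "norm (of_real (bessel_moment a b k) * z ^ k :: complex) \<le> (\<bar>b\<bar> * norm z) ^ k / fact k"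
proof -
  have "norm (of_real (bessel_moment a b k) * z ^ k) = \<bar>bessel_moment a b k\<bar> * norm z ^ k"
    by (simp add: norm_mult norm_power)
  also have "\<dots> \<le> \<bar>b\<bar> ^ k / fact k * norm z ^ k"
    by (intro mult_right_mono abs_bessel_moment_le assms) auto
  finally show ?thesis by (simp add: power_mult_distrib)
qed

lemma summable_power_div_fact: "summable (\<lambda>k. x ^ k / fact k :: real)"
  using summable_exp[of x] by (simp add: field_simps)

lemma bessel_gen_sums:
  assumes "a > 1"
  shows "(\<lambda>k. of_real (bessel_moment a b k) * z ^ k) sums bessel_gen a b z"
  unfolding bessel_gen_def
  by (intro summable_sums summable_comparison_test'[OF summable_power_div_fact])
     (rule norm_bessel_term_le[OF assms])

lemma bessel_gen_cnj:
  assumes "a > 1"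
  shows "bessel_gen a b (cnj z) = cnj (bessel_gen a b z)"
proof -
  have "(\<lambda>k. cnj (of_real (bessel_moment a b k) * z ^ k)) sums cnj (bessel_gen a b z)"
    unfolding sums_cnj by (rule bessel_gen_sums[OF assms])
  then show ?thesis
    using bessel_gen_sums[OF assms, of b "cnj z"] sums_unique2 by fastforce
qed

text \<open>Expanding the exponential leaves Beta integrals. The weight is unbounded near u = 1 when
  a < 2, so sum and integral are exchanged by dominated convergence.\<close>

lemma bessel_gen_has_integral:
  assumes a: "a > 1"
  shows "((\<lambda>u. exp (- (of_real (b * u) * z)) * of_real ((a - 1) * (1 - u) powr (a - 2)))
           has_integral bessel_gen a b z) {0..1}"
proof -
  define w where "w = (\<lambda>u. (a - 1) * (1 - u) powr (a - 2))"
  define f where "f = (\<lambda>N u. \<Sum>k<N. (- (of_real (b * u) * z)) ^ k / fact k * complex_of_real (w u))"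
  have f: "(f N has_integral (\<Sum>k<N. of_real (bessel_moment a b k) * z ^ k)) {0..1}" for N
    unfolding f_def
  proof (intro has_integral_sum)
    fix k
    have "((\<lambda>u. complex_of_real ((a - 1) * (u ^ k * (1 - u) powr (a - 2)))) has_integral
            of_real ((a - 1) * (fact k / (pochhammer a k * (a - 1))))) {0..1}"
      by (intro has_integral_of_real has_integral_mult_right has_integral_power_mult_powr a)
    from has_integral_mult_right[OF this, of "(- (of_real b * z)) ^ k / fact k"]
    show "((\<lambda>u. (- (of_real (b * u) * z)) ^ k / fact k * complex_of_real (w u)) has_integral
            of_real (bessel_moment a b k) * z ^ k) {0..1}"
    proof (rule has_integral_eq_rhs[OF has_integral_eq, rotated])
      have "complex_of_real (a - 1) \<noteq> 0" using a by (metis of_real_eq_0_iff diff_gt_0_iff_gt less_irrefl)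
      then show "of_real (bessel_moment a b k) * z ^ k = (- (of_real b * z)) ^ k / fact k *
              complex_of_real ((a - 1) * (fact k / (pochhammer a k * (a - 1))))"
        by (simp add: bessel_moment_def power_mult_distrib power_minus' del: of_real_diff)
    qed (simp add: w_def power_mult_distrib power_minus')
  qed simp
  have w_int: "w integrable_on {0..1}"
    unfolding w_def using has_integral_power_mult_powr[OF a, of 0]
    by (intro integrable_on_mult_right) (auto simp: integrable_on_def)
  have w_pos: "w u \<ge> 0" for u using a by (simp add: w_def)
  have lim: "(\<lambda>N. f N u) \<longlonglongrightarrow> exp (- (of_real (b * u) * z)) * of_real (w u)" for u
  proof -
    have "(\<lambda>k. (- (of_real (b * u) * z)) ^ k / fact k * complex_of_real (w u)) sums
            (exp (- (of_real (b * u) * z)) * of_real (w u))"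
      using exp_converges[of "- (of_real (b * u) * z)"]
      by (intro sums_mult2) (simp add: scaleR_conv_of_real field_simps)
    then show ?thesis by (simp add: sums_def f_def)
  qed
  \<comment> \<open>As u \<le> 1, the partial sums stay below the full exponential series at |b|
    |z|, which gives an integrable majorant independent of N.\<close>
  have bound: "norm (f N u) \<le> exp (\<bar>b\<bar> * norm z) * w u" if "u \<in> {0..1}" for N u
  proof -
    have "norm (f N u) \<le> (\<Sum>k<N. (\<bar>b\<bar> * norm z) ^ k / fact k * w u)"
      unfolding f_def
    proof (rule sum_norm_le)
      fix k
      have "norm ((- (of_real (b * u) * z)) ^ k) \<le> (\<bar>b\<bar> * norm z) ^ k"
        unfolding norm_power
        by (rule power_mono) (use that in \<open>auto simp: norm_mult abs_mult intro!: mult_right_mono mult_left_le\<close>)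
      then show "norm ((- (of_real (b * u) * z)) ^ k / fact k * complex_of_real (w u))
                  \<le> (\<bar>b\<bar> * norm z) ^ k / fact k * w u"
        by (simp add: norm_mult norm_divide w_pos mult_right_mono divide_right_mono)
    qed
    also have "\<dots> = (\<Sum>k<N. (\<bar>b\<bar> * norm z) ^ k / fact k) * w u"
      by (simp add: sum_distrib_right)
    also have "\<dots> \<le> exp (\<bar>b\<bar> * norm z) * w u"
    proof (intro mult_right_mono w_pos)
      have s: "(\<lambda>k. (\<bar>b\<bar> * norm z) ^ k / fact k) sums exp (\<bar>b\<bar> * norm z)"
        using exp_converges[of "\<bar>b\<bar> * norm z"] by (simp add: field_simps)
      show "(\<Sum>k<N. (\<bar>b\<bar> * norm z) ^ k / fact k) \<le> exp (\<bar>b\<bar> * norm z)"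
        by (rule order_trans[OF sum_le_suminf[OF sums_summable[OF s]]])
           (use sums_unique[OF s] in auto)
    qed
    finally show ?thesis .
  qed
  have fi: "f N integrable_on {0..1}" for N using f by blast
  have hi: "(\<lambda>u. exp (\<bar>b\<bar> * norm z) * w u) integrable_on {0..1}"
    by (intro integrable_on_mult_right w_int)
  note dc = dominated_convergence[OF fi hi bound lim]
  have "(\<lambda>N. integral {0..1} (f N)) = (\<lambda>N. \<Sum>k<N. of_real (bessel_moment a b k) * z ^ k)"
    using f by (auto intro!: integral_unique)
  with dc(2) have "bessel_gen a b z =
      integral {0..1} (\<lambda>u. exp (- (of_real (b * u) * z)) * of_real (w u))"
    using bessel_gen_sums[OF a, of b z] LIMSEQ_unique by (fastforce simp: sums_def)
  then show ?thesis
    using dc(1) unfolding w_def by (simp only: has_integral_integral)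
qed

section \<open>The weight in terms of the generating function\<close>

lemma bessel_p_has_integral:
  assumes "a > 1"
  shows "((\<lambda>u. exp (- b * u * cos \<theta>) * cos (b * u * sin \<theta>) * (1 - u) powr (a - 2))
           has_integral Re (bessel_gen a b (cis \<theta>)) / (a - 1)) {0..1}"
proof -
  have "((\<lambda>u. Re (exp (- (of_real (b * u) * cis \<theta>)) * of_real ((a - 1) * (1 - u) powr (a - 2))))
           has_integral Re (bessel_gen a b (cis \<theta>))) {0..1}"
    by (intro has_integral_Re bessel_gen_has_integral assms)
  from has_integral_divide[OF this, of "a - 1"] show ?thesis
    by (rule has_integral_eq_rhs[OF has_integral_eq, rotated])
       (use assms in \<open>auto simp: Re_exp mult.assoc\<close>)
qed

lemma bessel_p_eq_Re:
  assumes "a > 1"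
  shows "2 * pi * bessel_p \<theta> a b = - 1 + 2 * Re (bessel_gen a b (cis \<theta>))"
proof -
  have "2 * (a - 1) * (x / (a - 1)) = 2 * x" for x
    using assms by (simp add: field_simps)
  then show ?thesis
    unfolding bessel_p_def integral_unique[OF bessel_p_has_integral[OF assms]]
    by (simp del: times_divide_eq_right) simp
qed

text \<open>Here 2 Re F = F + cnj F, and F commutes with conjugation because its coefficients are
  real. This form displays the Fourier series of the weight, with both signs of the
  frequency.\<close>

lemma bessel_p_conv_gen:
  assumes "a > 1"
  shows "complex_of_real (2 * pi * bessel_p \<theta> a b)
           = - 1 + bessel_gen a b (cis \<theta>) + bessel_gen a b (cis (- \<theta>))"
proof -
  have "bessel_gen a b (cis (- \<theta>)) = cnj (bessel_gen a b (cis \<theta>))"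
    using bessel_gen_cnj[OF assms, of b "cis \<theta>"] by (simp add: cis_cnj)
  then show ?thesis
    by (simp add: bessel_p_eq_Re[OF assms] complex_eq_iff del: of_real_mult)
qed

subsection \<open>Positivity\<close>

text \<open>The two factors are bounded below separately, since |s cos \<theta>| and |s sin
  \<theta>| are both at most r. The bound r \<le> pi / 2 keeps cos r nonnegative, so that the
  estimates may be multiplied.\<close>

lemma exp_mult_cos_lower_bound:
  fixes s \<theta> :: real
  assumes "\<bar>s\<bar> \<le> r" "r \<le> pi / 2"
  shows "exp (- r) * cos r \<le> exp (- s * cos \<theta>) * cos (s * sin \<theta>)"
proof -
  have c: "\<bar>s * cos \<theta>\<bar> \<le> r" "\<bar>s * sin \<theta>\<bar> \<le> r"
    using assms mult_left_le[of "\<bar>cos \<theta>\<bar>" "\<bar>s\<bar>"] mult_left_le[of "\<bar>sin \<theta>\<bar>" "\<bar>s\<bar>"]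
    by (auto simp: abs_mult)
  have "cos r \<le> cos \<bar>s * sin \<theta>\<bar>"
    using c assms by (intro cos_monotone_0_pi_le) auto
  then have "cos r \<le> cos (s * sin \<theta>)" by simp
  moreover have "exp (- r) \<le> exp (- s * cos \<theta>)" using c by simp
  moreover have "0 \<le> cos r" using assms by (intro cos_ge_zero) auto
  ultimately show ?thesis by (intro mult_mono) auto
qed

lemma bessel_p_pos:
  assumes a: "a > 1" and b: "\<bar>b\<bar> \<le> pi / 2" "exp \<bar>b\<bar> < 2 * cos b"
  shows "bessel_p \<theta> a b > 0"
proof -
  define m where "m = exp (- \<bar>b\<bar>) * cos \<bar>b\<bar>"
  have "m > 1 / 2"
    using b(2) by (simp add: m_def exp_minus field_simps)
  let ?I = "Re (bessel_gen a b (cis \<theta>)) / (a - 1)"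
  \<comment> \<open>The Beta integral for k = 0: the constant m integrates against the weight to m /
    (a - 1), whence Re F \<ge> m > 1/2.\<close>
  have "((\<lambda>u. m * (u ^ 0 * (1 - u) powr (a - 2)))
          has_integral m * (fact 0 / (pochhammer a 0 * (a - 1)))) {0..1}"
    by (intro has_integral_mult_right has_integral_power_mult_powr a)
  then have "m * (fact 0 / (pochhammer a 0 * (a - 1))) \<le> ?I"
  proof (rule has_integral_le[OF _ bessel_p_has_integral[OF a]])
    fix u :: real assume u: "u \<in> {0..1}"
    then have "\<bar>b * u\<bar> \<le> \<bar>b\<bar>" by (auto simp: abs_mult intro: mult_left_le)
    from exp_mult_cos_lower_bound[OF this b(1), of \<theta>]
    have "m \<le> exp (- b * u * cos \<theta>) * cos (b * u * sin \<theta>)" by (simp add: m_def)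
    then show "m * (u ^ 0 * (1 - u) powr (a - 2))
        \<le> exp (- b * u * cos \<theta>) * cos (b * u * sin \<theta>) * (1 - u) powr (a - 2)"
      by (simp add: mult_right_mono)
  qed
  then have "m \<le> Re (bessel_gen a b (cis \<theta>))" using a by (simp add: divide_le_cancel)
  with \<open>m > 1 / 2\<close> have "2 * pi * bessel_p \<theta> a b > 0"
    unfolding bessel_p_eq_Re[OF a] by simp
  then show ?thesis by (simp add: zero_less_mult_iff)
qed

subsection \<open>Moments of the weight\<close>

text \<open>Weierstrass M-test with majorant 2 |b|^k / k!. The factor
  \<open>cis \<theta> ^ m\<close> is carried along so that one statement serves both continuity (m =
  0) and every moment. Adding 1 absorbs the constant -1 of the weight.\<close>

lemma bessel_p_uniform_limit:
  fixes m :: nat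
  assumes a: "a > 1"
  shows "uniform_limit S
    (\<lambda>N \<theta>. \<Sum>k<N. cis \<theta> ^ m * (of_real (bessel_moment a b k) * (cis \<theta> ^ k + cis (- \<theta>) ^ k)))
    (\<lambda>\<theta>. cis \<theta> ^ m * (1 + of_real (2 * pi * bessel_p \<theta> a b))) sequentially"
proof -
  let ?t = "\<lambda>k \<theta>. cis \<theta> ^ m * (complex_of_real (bessel_moment a b k) * (cis \<theta> ^ k + cis (- \<theta>) ^ k))"
  have "uniform_limit S (\<lambda>N \<theta>. \<Sum>k<N. ?t k \<theta>) (\<lambda>\<theta>. suminf (\<lambda>k. ?t k \<theta>)) sequentially"
  proof (rule Weierstrass_m_test)
    fix k \<theta>
    have "norm (cis \<theta> ^ k + cis (- \<theta>) ^ k) \<le> 2"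
      by (rule norm_triangle_le) (simp add: norm_power)
    then have "norm (?t k \<theta>) \<le> \<bar>bessel_moment a b k\<bar> * 2"
      by (simp add: norm_mult norm_power mult_left_mono)
    also have "\<dots> \<le> \<bar>b\<bar> ^ k / fact k * 2"
      using abs_bessel_moment_le[OF a] by (rule mult_right_mono) auto
    finally show "norm (?t k \<theta>) \<le> \<bar>b\<bar> ^ k / fact k * 2" .
  qed (intro summable_mult2 summable_power_div_fact)
  moreover have "suminf (\<lambda>k. ?t k \<theta>) = cis \<theta> ^ m * (1 + of_real (2 * pi * bessel_p \<theta> a b))" for \<theta>
  proof -
    have "(\<lambda>k. ?t k \<theta>) sums (cis \<theta> ^ m * (bessel_gen a b (cis \<theta>) + bessel_gen a b (cis (- \<theta>))))"
      unfolding distrib_left[of "complex_of_real _"]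
      by (intro sums_mult sums_add bessel_gen_sums a)
    then show ?thesis
      unfolding bessel_p_conv_gen[OF a] by (simp add: sums_iff)
  qed
  ultimately show ?thesis by simp
qed

lemma continuous_on_bessel_p:
  assumes "a > 1"
  shows "continuous_on S (\<lambda>\<theta>. bessel_p \<theta> a b)"
proof -
  have "continuous_on S (\<lambda>\<theta>. cis \<theta> ^ 0 * (1 + of_real (2 * pi * bessel_p \<theta> a b)))"
    by (rule uniform_limit_theorem[OF _ bessel_p_uniform_limit[OF assms]])
       (auto intro!: always_eventually continuous_intros)
  then have "continuous_on S (\<lambda>\<theta>. (Re (cis \<theta> ^ 0 * (1 + of_real (2 * pi * bessel_p \<theta> a b))) - 1) / (2 * pi))"
    by (intro continuous_on_divide continuous_on_diff continuous_on_Re continuous_on_const) auto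
  then show ?thesis by simp
qed

text \<open>Orthogonality of the characters of the circle. The frequency is an integer because
  differences m - k occur below.\<close>

lemma has_integral_cis_of_int:
  "((\<lambda>\<theta>. cis (of_int n * \<theta>)) has_integral (if n = 0 then 2 * pi else 0)) {0..2 * pi}"
proof (cases "n = 0")
  case True
  then show ?thesis using has_integral_const_real[of "1::complex" 0 "2 * pi"] by (simp add: scaleR_conv_of_real)
next
  case False
  let ?F = "\<lambda>\<theta>. cis (of_int n * \<theta>) / (\<i> * of_int n)"
  have "((\<lambda>\<theta>. cis (of_int n * \<theta>)) has_integral (?F (2 * pi) - ?F 0)) {0..2 * pi}"
  proof (rule fundamental_theorem_of_calculus)
    fix \<theta> :: real
    show "(?F has_vector_derivative cis (of_int n * \<theta>)) (at \<theta> within {0..2 * pi})"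
    proof -
      have "((\<lambda>z. exp (\<i> * (of_int n * z)) / (\<i> * of_int n)) has_field_derivative
              exp (\<i> * (of_int n * of_real \<theta>))) (at (of_real \<theta>))"
        using False by (auto intro!: derivative_eq_intros simp: field_simps)
      from has_vector_derivative_real_field[OF this] show ?thesis
        by (simp add: cis_conv_exp)
    qed
  qed simp
  moreover have "cis (of_int n * (2 * pi)) = 1"
    using cos_int_2pin[of n] sin_int_2pin[of n] by (simp add: complex_eq_iff mult.commute[of "of_int n"])
  ultimately show ?thesis using False by simp
qed

text \<open>The uniformly convergent series is integrated term by term, and only frequency 0
  survives. For m = 0 the constant term is counted twice, once from F(z) and once from F(1/z); the
  summand -1 in the weight corrects this.\<close>

lemma bessel_p_moment:
  assumes a: "a > 1"
  shows "((\<lambda>\<theta>. cis \<theta> ^ m * of_real (bessel_p \<theta> a b)) has_integral of_real (bessel_moment a b m)) {0..2 * pi}"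
proof -
  let ?f = "\<lambda>N \<theta>. \<Sum>k<N. cis \<theta> ^ m * (complex_of_real (bessel_moment a b k) * (cis \<theta> ^ k + cis (- \<theta>) ^ k))"
  let ?g = "\<lambda>\<theta>. cis \<theta> ^ m * (1 + complex_of_real (2 * pi * bessel_p \<theta> a b))"
  let ?I = "\<lambda>N. \<Sum>k<N. complex_of_real (bessel_moment a b k) *
      ((if int m + int k = 0 then 2 * pi else 0) + (if int m - int k = 0 then 2 * pi else 0))"
  have fI: "(?f N has_integral ?I N) {0..2 * pi}" for N
  proof (intro has_integral_sum)
    fix k
    have eq: "cis \<theta> ^ m * (complex_of_real (bessel_moment a b k) * (cis \<theta> ^ k + cis (- \<theta>) ^ k)) =
       complex_of_real (bessel_moment a b k) *
             (cis (of_int (int m + int k) * \<theta>) + cis (of_int (int m - int k) * \<theta>))" for \<theta>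
      by (simp add: Complex.DeMoivre cis_mult distrib_left distrib_right left_diff_distrib mult.left_commute[of "cis _"])
    show "((\<lambda>\<theta>. cis \<theta> ^ m * (complex_of_real (bessel_moment a b k) * (cis \<theta> ^ k + cis (- \<theta>) ^ k)))
       has_integral complex_of_real (bessel_moment a b k) *
      ((if int m + int k = 0 then 2 * pi else 0) + (if int m - int k = 0 then 2 * pi else 0))) {0..2 * pi}"
      unfolding eq of_real_add by (intro has_integral_mult_right has_integral_add has_integral_cis_of_int)
  qed simp
  obtain I J where I: "\<And>N. (?f N has_integral I N) {0..2 * pi}" and J: "(?g has_integral J) {0..2 * pi}"
    and lim: "I \<longlonglongrightarrow> J"
    by (rule uniform_limit_integral[OF bessel_p_uniform_limit[OF a, where S = "{0..2 * pi}" and m = m and b = b]])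
       (auto intro!: continuous_intros)
  \<comment> \<open>Once N > m, the partial sum contains every term with a nonzero integral, so the
    sequence of integrals is eventually constant.\<close>
  have "I N = of_real (2 * pi) * (of_real (bessel_moment a b m) + (if m = 0 then 1 else 0))" if "N > m" for N
  proof -
    have "I N = ?I N" by (rule has_integral_unique[OF I fI])
    \<comment> \<open>The first summand comes from frequency m - k. The second comes from m + k,
      which vanishes only for m = k = 0.\<close>
    also have "\<dots> = (\<Sum>k<N. (if k = m then of_real (2 * pi * bessel_moment a b m) else 0) +
        (if k = 0 then (if m = 0 then of_real (2 * pi) else 0) else 0))"
      by (rule sum.cong) auto
    also have "\<dots> = of_real (2 * pi) * (of_real (bessel_moment a b m) + (if m = 0 then 1 else 0))"
      using that by (simp add: sum.distrib algebra_simps)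
    finally show ?thesis .
  qed
  then have "\<forall>\<^sub>F N in sequentially. I N = of_real (2 * pi) * (of_real (bessel_moment a b m) + (if m = 0 then 1 else 0))"
    by (auto intro: eventually_mono[OF eventually_gt_at_top[of m]])
  from LIMSEQ_unique[OF lim tendsto_eventually[OF this]] have J_eq: "J = of_real (2 * pi) * (of_real (bessel_moment a b m) + (if m = 0 then 1 else 0))"
    .
  have c: "((\<lambda>\<theta>. cis \<theta> ^ m) has_integral of_real (if m = 0 then 2 * pi else 0)) {0..2 * pi}"
    using has_integral_cis_of_int[of "int m"] by (simp add: Complex.DeMoivre)
  have "((\<lambda>\<theta>. (?g \<theta> - cis \<theta> ^ m) / of_real (2 * pi)) has_integral
      (of_real (2 * pi) * (of_real (bessel_moment a b m) + (if m = 0 then 1 else 0))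
         - of_real (if m = 0 then 2 * pi else 0)) / of_real (2 * pi)) {0..2 * pi}"
    by (rule has_integral_divide[OF has_integral_diff[OF J[unfolded J_eq] c]])
  then show ?thesis
    by (rule has_integral_eq_rhs[OF has_integral_eq, rotated]) (auto simp: distrib_left)
qed

subsection \<open>Orthogonality\<close>

definition bessel_poly_coeff :: "real \<Rightarrow> real \<Rightarrow> nat \<Rightarrow> nat \<Rightarrow> real" where
  "bessel_poly_coeff a b n j =
     pochhammer (- real n) j * pochhammer (real n + a - 1) j / fact j * (- (1 / b)) ^ j"

lemma bessel_poly_conv_coeff:
  "bessel_poly n x (of_real a) (of_real b) = (\<Sum>j\<le>n. of_real (bessel_poly_coeff a b n j) * x ^ j)"
  unfolding bessel_poly_def
proof (rule sum.cong)
  fix j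
  have "pochhammer (- of_nat n) j = complex_of_real (pochhammer (- real n) j)"
    by (simp flip: pochhammer_of_real)
  moreover have "pochhammer (of_nat n + of_real a - 1) j = complex_of_real (pochhammer (real n + a - 1) j)"
    by (simp flip: pochhammer_of_real)
  moreover have "(- (x / of_real b)) ^ j = complex_of_real ((- (1 / b)) ^ j) * x ^ j"
    by (simp flip: power_mult_distrib)
  ultimately show "pochhammer (- of_nat n) j * pochhammer (of_nat n + complex_of_real a - 1) j / fact j *
      (- (x / of_real b)) ^ j = of_real (bessel_poly_coeff a b n j) * x ^ j"
    by (simp add: bessel_poly_coeff_def)
qed simp

text \<open>The left side is the integral of z^i y_n against p. The powers of b from coefficient and
  moment cancel up to the factor \<open>bessel_moment a b i\<close>, leaving the terminating series
  2F1(-n, n + a - 1; a + i; 1), which Chu-Vandermonde sums.\<close>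

lemma sum_bessel_poly_coeff_moment:
  assumes a: "a > 1" and b: "b \<noteq> 0"
  shows "(\<Sum>j\<le>n. bessel_poly_coeff a b n j * bessel_moment a b (i + j)) =
     bessel_moment a b i * pochhammer (real i + 1 - real n) n / pochhammer (a + real i) n"
proof -
  have "(\<Sum>j\<le>n. bessel_poly_coeff a b n j * bessel_moment a b (i + j)) =
     (\<Sum>j\<in>{0..n}. bessel_moment a b i * (pochhammer (real n + a - 1) j * pochhammer (- of_nat n) j /
        (of_nat (fact j) * pochhammer (a + real i) j)))"
  proof (rule sum.cong)
    fix j
    have "(- (1 / b)) ^ j * (- b) ^ j = 1"
      using b by (simp flip: power_mult_distrib)
    then have "bessel_moment a b (i + j) * (- (1 / b)) ^ j =
        bessel_moment a b i / pochhammer (a + real i) j"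
      by (simp add: bessel_moment_def pochhammer_product' power_add mult_ac)
    moreover have "bessel_poly_coeff a b n j * bessel_moment a b (i + j) =
      pochhammer (- real n) j * pochhammer (real n + a - 1) j / fact j * (bessel_moment a b (i + j) * (- (1 / b)) ^ j)"
      by (simp add: bessel_poly_coeff_def)
    ultimately show "bessel_poly_coeff a b n j * bessel_moment a b (i + j) =
      bessel_moment a b i * (pochhammer (real n + a - 1) j * pochhammer (- of_nat n) j /
        (of_nat (fact j) * pochhammer (a + real i) j))"
      by (simp add: mult_ac)
  qed auto
  also have "\<dots> = bessel_moment a b i * (pochhammer (a + real i - (real n + a - 1)) n / pochhammer (a + real i) n)"
    unfolding sum_distrib_left[symmetric] using a by (subst Vandermonde_pochhammer) auto
  finally show ?thesis by (simp add: algebra_simps)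
qed

text \<open>Both products have the factors a, ..., a + k - 1, in opposite order; the reflection of
  the index matches them.\<close>

lemma falling_fact_conv_pochhammer:
  "falling_fact (a + of_nat k - 1) k = pochhammer (a :: real) k"
  unfolding falling_fact_def pochhammer_prod lessThan_atLeast0
  by (rule prod.reindex_bij_witness[of _ "\<lambda>i. k - 1 - i" "\<lambda>i. k - 1 - i"]) auto

text \<open>Only the top power of y_n contributes to the integral of y_n^2 p: the left side is the
  leading coefficient times the integral of z^n y_n p, where (1)_n = n!.\<close>

lemma bessel_poly_norm:
  assumes a: "a > 1" and b: "b \<noteq> 0"
  shows "bessel_poly_coeff a b n n * (bessel_moment a b n * fact n / pochhammer (a + real n) n) =
     - bessel_c n a b / b"
proof (cases n)
  case 0
  then show ?thesis using b by (simp add: bessel_poly_coeff_def bessel_c_def)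
next
  case (Suc k)
  have pos: "pochhammer x j > 0" if "x > 0" for x :: real and j using that by (rule pochhammer_pos)
  define P where "P = pochhammer (a + real k) (Suc k)"
  have "P > 0" using a by (auto simp: P_def intro: pos)
  \<comment> \<open>With n = k + 1, (a)_(2n) is split as (a)_n (a + n)_n and as (a)_k (a + k)_(n+1).
    The last factor of the latter is 2n + a - 1, and the remaining \<open>P\<close> cancels against
    the numerator of the leading coefficient.\<close>
  have "pochhammer a (n + n) = pochhammer a (k + Suc n)" using Suc by simp
  also have "\<dots> = pochhammer a k * (P * (2 * real n + a - 1))"
    unfolding pochhammer_product'[of a k "Suc n"] pochhammer_Suc[of _ n] P_def using Suc
    by (simp del: pochhammer_Suc add: algebra_simps)
  finally have poch: "pochhammer a n * pochhammer (a + real n) n = pochhammer a k * (P * (2 * real n + a - 1))"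
    by (simp add: pochhammer_product')
  have "pochhammer (- real n) n = (- 1) ^ n * fact n" by (rule pochhammer_same)
  moreover have "pochhammer (real n + a - 1) n = P" by (simp add: P_def Suc add.commute)
  moreover have "(- (1 / b)) ^ n * (- b) ^ n = 1" using b by (simp flip: power_mult_distrib)
  ultimately have "bessel_poly_coeff a b n n * (bessel_moment a b n * fact n / pochhammer (a + real n) n)
      = (- 1) ^ n * fact n * P / (pochhammer a n * pochhammer (a + real n) n)"
    by (simp add: bessel_poly_coeff_def bessel_moment_def)
  also have "\<dots> = (- 1) ^ n * fact n / ((2 * real n + a - 1) * pochhammer a k)"
    unfolding poch using \<open>P > 0\<close> by simp
  also have "\<dots> = - bessel_c n a b / b"
  proof -
    have "falling_fact (real n + a - 2) (n - 1) = pochhammer a k"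
      using falling_fact_conv_pochhammer[of a k] Suc by (simp add: algebra_simps)
    then show ?thesis using b Suc by (simp add: bessel_c_def del: of_nat_Suc fact_Suc)
  qed
  finally show ?thesis .
qed

text \<open>After both polynomials are expanded, the inner sum over j is the pairing of y_n with
  z^i. For i \<le> m \<le> n it is nonzero only if i = n, which forces m = n.\<close>

lemma bessel_poly_orthogonal_le:
  assumes a: "a > 1" and b: "b \<noteq> 0" and "m \<le> n"
  shows "((\<lambda>\<theta>. bessel_poly n (cis \<theta>) (of_real a) (of_real b) * bessel_poly m (cis \<theta>) (of_real a) (of_real b)
             * of_real (bessel_p \<theta> a b))
          has_integral of_real (- bessel_c n a b / b * (if n = m then 1 else 0))) {0..2 * pi}"
proof -
  let ?c = "bessel_poly_coeff a b" and ?\<mu> = "bessel_moment a b"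
  have "((\<lambda>\<theta>. \<Sum>i\<le>m. \<Sum>j\<le>n. of_real (?c m i) * (of_real (?c n j) *
            (cis \<theta> ^ (i + j) * of_real (bessel_p \<theta> a b))))
         has_integral (\<Sum>i\<le>m. \<Sum>j\<le>n. of_real (?c m i) * (of_real (?c n j) * of_real (?\<mu> (i + j))))) {0..2 * pi}"
    by (intro has_integral_sum has_integral_mult_right bessel_p_moment a) auto
  moreover have "(\<Sum>i\<le>m. \<Sum>j\<le>n. of_real (?c m i) * (of_real (?c n j) * of_real (?\<mu> (i + j)))) =
      complex_of_real (- bessel_c n a b / b * (if n = m then 1 else 0))"
  proof -
    have "(\<Sum>i\<le>m. \<Sum>j\<le>n. ?c m i * (?c n j * ?\<mu> (i + j))) =
        (\<Sum>i\<le>m. if i = n then - bessel_c n a b / b else 0)"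
    proof (rule sum.cong)
      fix i assume i: "i \<in> {..m}"
      have "(\<Sum>j\<le>n. ?c m i * (?c n j * ?\<mu> (i + j))) =
          ?c m i * (?\<mu> i * pochhammer (real i + 1 - real n) n / pochhammer (a + real i) n)"
        unfolding sum_distrib_left[symmetric] sum_bessel_poly_coeff_moment[OF a b] ..
      also have "\<dots> = (if i = n then - bessel_c n a b / b else 0)"
      proof (cases "i = n")
        case True
        then have "m = n" using i \<open>m \<le> n\<close> by auto
        then show ?thesis
          using bessel_poly_norm[OF a b, of n] True by (simp add: pochhammer_fact)
      next
        case False
        then have "i < n" using i \<open>m \<le> n\<close> by auto
        \<comment> \<open>The factor of index n - 1 - i is i + 1 - n + (n - 1 - i) = 0.\<close>
        then have "pochhammer (real i + 1 - real n) n = 0"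
          unfolding pochhammer_eq_0_iff by (intro exI[of _ "n - 1 - i"]) auto
        then show ?thesis using False by simp
      qed
      finally show "(\<Sum>j\<le>n. ?c m i * (?c n j * ?\<mu> (i + j))) = (if i = n then - bessel_c n a b / b else 0)" .
    qed simp
    also have "\<dots> = - bessel_c n a b / b * (if n = m then 1 else 0)"
      using \<open>m \<le> n\<close> by auto
    finally show ?thesis
      by (simp only: of_real_sum[symmetric] of_real_mult[symmetric])
  qed
  moreover have "(\<Sum>i\<le>m. \<Sum>j\<le>n. of_real (?c m i) * (of_real (?c n j) *
            (cis \<theta> ^ (i + j) * of_real (bessel_p \<theta> a b)))) =
     bessel_poly n (cis \<theta>) (of_real a) (of_real b) * bessel_poly m (cis \<theta>) (of_real a) (of_real b)
             * of_real (bessel_p \<theta> a b)" for \<theta>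
  proof -
    have "(\<Sum>i\<le>m. \<Sum>j\<le>n. of_real (?c m i) * (of_real (?c n j) *
            (cis \<theta> ^ (i + j) * of_real (bessel_p \<theta> a b)))) =
       (\<Sum>i\<le>m. of_real (?c m i) * cis \<theta> ^ i) * (\<Sum>j\<le>n. of_real (?c n j) * cis \<theta> ^ j) * of_real (bessel_p \<theta> a b)"
      unfolding sum_product unfolding sum_distrib_right by (intro sum.cong refl) (simp add: power_add)
    then show ?thesis by (simp add: bessel_poly_conv_coeff mult.commute)
  qed
  ultimately show ?thesis by simp
qed

lemma bessel_poly_orthogonal:
  assumes a: "a > 1" and b: "b \<noteq> 0"
  shows "((\<lambda>\<theta>. bessel_poly n (cis \<theta>) (of_real a) (of_real b) * bessel_poly m (cis \<theta>) (of_real a) (of_real b)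
             * of_real (bessel_p \<theta> a b))
          has_integral of_real (- bessel_c n a b / b * (if n = m then 1 else 0))) {0..2 * pi}"
proof (cases "m \<le> n")
  case True
  then show ?thesis by (rule bessel_poly_orthogonal_le[OF a b])
next
  case False
  then have "n \<le> m" "n \<noteq> m" by auto
  \<comment> \<open>The integrand is symmetric in n and m, and off the diagonal the value is 0, so
    exchanging the index of \<open>bessel_c\<close> is harmless.\<close>
  with bessel_poly_orthogonal_le[OF a b, of n m] show ?thesis by (simp add: mult.commute)
qed

subsection \<open>The complex weight\<close>

text \<open>The term j = 0 is Gamma(a) / Gamma(a - 1) = a - 1. With j = k + 1 the Gamma quotient
  becomes 1 / (a)_k, so the remaining terms are -b/z times the series of F(1/z). As a > 1, every
  argument a + j - 1 is positive and avoids the poles of Gamma.\<close>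

lemma bessel_rho_conv_gen:
  assumes a: "a > 1" and "z \<noteq> 0"
  shows "2 * of_real pi * \<i> * bessel_rho z (of_real a) (of_real b) =
    of_real (a - 1) - of_real b / z * bessel_gen a b (1 / z)"
proof -
  let ?t = "\<lambda>j. Gamma (complex_of_real a) / Gamma (of_real a + of_nat j - 1) * (- (of_real b / z)) ^ j"
  have t_Suc: "?t (Suc k) = - (of_real b / z) * (of_real (bessel_moment a b k) * (1 / z) ^ k)" for k
  proof -
    have na: "a \<notin> \<int>\<^sub>\<le>\<^sub>0" using a nonpos_Ints_nonpos[of a] by force
    have "Gamma (complex_of_real a) / Gamma (of_real a + of_nat k) = of_real (1 / pochhammer a k)"
      using Gamma_complex_of_real[of a] Gamma_complex_of_real[of "a + real k"]
      by (simp add: pochhammer_Gamma[OF na])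
    moreover have "(- (of_real b / z)) ^ k = of_real ((- b) ^ k) * (1 / z) ^ k"
    proof -
      have "- (of_real b / z) = of_real (- b) * (1 / z)" by simp
      then show ?thesis by (simp only: of_real_power power_mult_distrib)
    qed
    ultimately show ?thesis by (simp add: bessel_moment_def)
  qed
  have t_0: "?t 0 = of_real (a - 1)"
  proof -
    have "Gamma a = (a - 1) * Gamma (a - 1)"
      using Gamma_plus1[of "a - 1"] a nonpos_Ints_nonpos[of "a - 1"] by force
    moreover have "Gamma (a - 1) > 0" using a by simp
    ultimately have "Gamma a / Gamma (a - 1) = a - 1" by simp
    moreover have "?t 0 = of_real (Gamma a / Gamma (a - 1))"
      using Gamma_complex_of_real[of a] Gamma_complex_of_real[of "a - 1"] by simp
    ultimately show ?thesis by simp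
  qed
  have "(\<lambda>k. ?t (Suc k)) sums (- (of_real b / z) * bessel_gen a b (1 / z))"
    unfolding t_Suc by (intro sums_mult bessel_gen_sums a)
  from sums_Suc[OF this] have "suminf ?t = of_real (a - 1) - of_real b / z * bessel_gen a b (1 / z)"
    unfolding t_0 by (simp add: sums_iff)
  then show ?thesis by (simp add: bessel_rho_def)
qed

text \<open>Multiplying \<rho>(z) by z clears the denominator. Adding the values at \<theta> and
  -\<theta> gives 2(a - 1) cos \<theta> from the linear parts and the symmetric sum F(z) + F(1/z)
  from the rest.\<close>

lemma bessel_p_conv_rho:
  assumes a: "a > 1" and b: "b \<noteq> 0"
  shows "complex_of_real (2 * pi * bessel_p \<theta> a b)
         = - 1 + complex_of_real (2 * (a - 1) / b * cos \<theta>)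
           - 2 * complex_of_real pi * \<i> / complex_of_real b *
             (cis \<theta> * bessel_rho (cis \<theta>) (of_real a) (of_real b)
              + cis (- \<theta>) * bessel_rho (cis (- \<theta>)) (of_real a) (of_real b))"
proof -
  have rho: "2 * complex_of_real pi * \<i> * (cis t * bessel_rho (cis t) (of_real a) (of_real b)) =
      of_real (a - 1) * cis t - of_real b * bessel_gen a b (cis (- t))" for t
  proof -
    have "2 * complex_of_real pi * \<i> * (cis t * bessel_rho (cis t) (of_real a) (of_real b)) =
        cis t * (2 * complex_of_real pi * \<i> * bessel_rho (cis t) (of_real a) (of_real b))"
      by simp
    also have "\<dots> = of_real (a - 1) * cis t - of_real b * bessel_gen a b (cis (- t))"
    proof -
      have "1 / cis t = cis (- t)" by (simp add: divide_inverse)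
      then show ?thesis
        unfolding bessel_rho_conv_gen[OF a cis_neq_zero] by (simp add: right_diff_distrib del: of_real_diff)
    qed
    finally show ?thesis .
  qed
  have "2 * complex_of_real pi * \<i> / complex_of_real b *
             (cis \<theta> * bessel_rho (cis \<theta>) (of_real a) (of_real b)
              + cis (- \<theta>) * bessel_rho (cis (- \<theta>)) (of_real a) (of_real b)) =
     (2 * complex_of_real pi * \<i> * (cis \<theta> * bessel_rho (cis \<theta>) (of_real a) (of_real b)) +
      2 * complex_of_real pi * \<i> * (cis (- \<theta>) * bessel_rho (cis (- \<theta>)) (of_real a) (of_real b))) / of_real b"
    by (simp only: distrib_left add_divide_distrib times_divide_eq_left)
  also have "\<dots> = (of_real (a - 1) * (cis \<theta> + cis (- \<theta>))) / of_real b - (bessel_gen a b (cis \<theta>) + bessel_gen a b (cis (- \<theta>)))"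
    unfolding rho using b by (simp add: add_divide_distrib diff_divide_distrib distrib_left)
  also have "cis \<theta> + cis (- \<theta>) = of_real (2 * cos \<theta>)"
    by (simp add: complex_eq_iff)
  finally have h: "2 * complex_of_real pi * \<i> / complex_of_real b *
             (cis \<theta> * bessel_rho (cis \<theta>) (of_real a) (of_real b)
              + cis (- \<theta>) * bessel_rho (cis (- \<theta>)) (of_real a) (of_real b)) =
     of_real (2 * (a - 1) / b * cos \<theta>) - (bessel_gen a b (cis \<theta>) + bessel_gen a b (cis (- \<theta>)))"
    by simp
  show ?thesis
    unfolding bessel_p_conv_gen[OF a] h by simp
qed

subsection \<open>The bound \<open>x\<^sub>0\<close>\<close>

text \<open>Both cos and -exp decrease here. This yields the uniqueness of the root as well as the
  strict inequality to its left.\<close>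

lemma two_cos_minus_exp_strict_decreasing:
  fixes x y :: real
  assumes "0 \<le> x" "x < y" "y \<le> pi"
  shows "2 * cos y - exp y < 2 * cos x - exp x"
  using cos_monotone_0_pi[of x y] assms by (smt (verit) exp_less_cancel_iff)

lemma ex1_two_cos_eq_exp: "\<exists>!x::real. x \<in> {0..pi / 2} \<and> 2 * cos x = exp x"
proof -
  \<comment> \<open>The difference is 1 at 0 and -exp(pi / 2) at the right end.\<close>
  have "\<exists>x\<ge>0. x \<le> pi / 2 \<and> 2 * cos x - exp x = 0"
    by (rule IVT2') (auto intro!: continuous_intros)
  then obtain x :: real where x: "x \<in> {0..pi / 2}" "2 * cos x - exp x = 0" by auto
  show ?thesis
  proof (rule ex1I[of _ x])
    fix y :: real assume y: "y \<in> {0..pi / 2} \<and> 2 * cos y = exp y"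
    show "y = x"
      using two_cos_minus_exp_strict_decreasing[of x y] two_cos_minus_exp_strict_decreasing[of y x] x y
      by (cases x y rule: linorder_cases) auto
  qed (use x in auto)
qed

lemma bessel_x0: "bessel_x0 \<in> {0..pi / 2}" "2 * cos bessel_x0 = exp bessel_x0"
  using theI'[OF ex1_two_cos_eq_exp] unfolding bessel_x0_def by auto

text \<open>If the root were at most 1/3 < pi/6, then 2 cos would be at least sqrt 3 > 1.7 there,
  whereas exp would be at most 1 + 1/3 + 1/9 < 1.5.\<close>

lemma bessel_x0_gt: "bessel_x0 > 1 / 3"
proof (rule ccontr)
  assume "\<not> bessel_x0 > 1 / 3"
  then have *: "bessel_x0 \<le> 1 / 3" by simp
  have "cos (pi / 6) \<le> cos bessel_x0"
    using * bessel_x0 pi_gt3 by (intro cos_monotone_0_pi_le) auto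
  moreover have "17 / 10 < sqrt 3" by (rule real_less_rsqrt) (simp add: power2_eq_square)
  moreover have "exp bessel_x0 \<le> exp (1 / 3)" using * by simp
  moreover have "exp (1 / 3 :: real) \<le> 1 + 1 / 3 + (1 / 3)\<^sup>2" by (rule exp_bound) auto
  ultimately show False using bessel_x0(2) unfolding cos_30 power2_eq_square by linarith
qed

text \<open>The decreasing function 2 cos - exp vanishes at \<open>bessel_x0\<close>, hence is
  positive at |b|; cos is even.\<close>

lemma exp_less_two_cos:
  assumes "\<bar>b\<bar> < bessel_x0"
  shows "exp \<bar>b\<bar> < 2 * cos b"
  using two_cos_minus_exp_strict_decreasing[of "\<bar>b\<bar>" bessel_x0] bessel_x0 assms pi_gt_zero by auto

theorem theorem1:
  shows "(\<exists>!x::real. x \<in> {0..pi / 2} \<and> 2 * cos x = exp x) \<and>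
    {- 1 / 3<..<1 / 3} - {0} \<subseteq> {- bessel_x0<..<bessel_x0} - {0} \<and>
    (\<forall>a b::real. a > 1 \<longrightarrow> b \<in> {- bessel_x0<..<bessel_x0} - {0} \<longrightarrow>
      (\<forall>\<theta>\<in>{0..2 * pi}. bessel_p \<theta> a b > 0) \<and>
      continuous_on {0..2 * pi} (\<lambda>\<theta>. bessel_p \<theta> a b) \<and>
      (\<forall>n m. ((\<lambda>\<theta>. bessel_poly n (exp (\<i> * complex_of_real \<theta>)) (complex_of_real a) (complex_of_real b)
                 * bessel_poly m (exp (\<i> * complex_of_real \<theta>)) (complex_of_real a) (complex_of_real b)
                 * complex_of_real (bessel_p \<theta> a b))
              has_integral complex_of_real (- bessel_c n a b / b * (if n = m then 1 else 0)))
             {0..2 * pi}) \<and>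
      (\<forall>\<theta>\<in>{0..2 * pi}.
         complex_of_real (2 * pi * bessel_p \<theta> a b)
         = - 1 + complex_of_real (2 * (a - 1) / b * cos \<theta>)
           - 2 * complex_of_real pi * \<i> / complex_of_real b *
             (exp (\<i> * complex_of_real \<theta>)
                * bessel_rho (exp (\<i> * complex_of_real \<theta>)) (complex_of_real a) (complex_of_real b)
              + exp (- \<i> * complex_of_real \<theta>)
                * bessel_rho (exp (- \<i> * complex_of_real \<theta>)) (complex_of_real a) (complex_of_real b))))"
proof (intro conjI allI impI ballI)
  show "\<exists>!x::real. x \<in> {0..pi / 2} \<and> 2 * cos x = exp x"
    by (rule ex1_two_cos_eq_exp)
  show "{- 1 / 3<..<1 / 3} - {0} \<subseteq> {- bessel_x0<..<bessel_x0} - {0}"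
    using bessel_x0_gt by auto
  fix a b :: real
  assume a: "a > 1" and "b \<in> {- bessel_x0<..<bessel_x0} - {0}"
  then have b: "\<bar>b\<bar> < bessel_x0" "b \<noteq> 0" by auto
  show "continuous_on {0..2 * pi} (\<lambda>\<theta>. bessel_p \<theta> a b)"
    by (rule continuous_on_bessel_p[OF a])
  have exp_cis: "exp (\<i> * complex_of_real \<theta>) = cis \<theta>" for \<theta>
    by (simp add: cis_conv_exp)
  have exp_minus_cis: "exp (- \<i> * complex_of_real \<theta>) = cis (- \<theta>)" for \<theta>
    by (simp add: cis_conv_exp)
  show "bessel_p \<theta> a b > 0" for \<theta>
    by (rule bessel_p_pos[OF a _ exp_less_two_cos[OF b(1)]]) (use bessel_x0(1) b(1) in simp)
  show "((\<lambda>\<theta>. bessel_poly n (exp (\<i> * complex_of_real \<theta>)) (complex_of_real a) (complex_of_real b)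
             * bessel_poly m (exp (\<i> * complex_of_real \<theta>)) (complex_of_real a) (complex_of_real b)
             * complex_of_real (bessel_p \<theta> a b))
          has_integral complex_of_real (- bessel_c n a b / b * (if n = m then 1 else 0))) {0..2 * pi}" for n m
    unfolding exp_cis by (rule bessel_poly_orthogonal[OF a b(2)])
  show "complex_of_real (2 * pi * bessel_p \<theta> a b)
         = - 1 + complex_of_real (2 * (a - 1) / b * cos \<theta>)
           - 2 * complex_of_real pi * \<i> / complex_of_real b *
             (exp (\<i> * complex_of_real \<theta>)
                * bessel_rho (exp (\<i> * complex_of_real \<theta>)) (complex_of_real a) (complex_of_real b)
              + exp (- \<i> * complex_of_real \<theta>)
                * bessel_rho (exp (- \<i> * complex_of_real \<theta>)) (complex_of_real a) (complex_of_real b))" for \<theta>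
    unfolding exp_cis exp_minus_cis by (rule bessel_p_conv_rho[OF a b(2)])
qed

end
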